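(* Let $k$ be a real number with $k>2(1+\sqrt5)$ and set $a=\sqrt{(4+k)/(4-k)}$, $c=k/\sqrt{4-k}$. Then $$\mathrm{m}(P_{1,k})=2\,\mathrm{m}(P_{a,c})+\frac12\log\left(\frac{k-4}{k+4}\right).$$
   Context: For complex numbers $a\neq 0$ and $c$, let $P_{a,c}(x,y)=a\left(x+\frac1x\right)+y+\frac1y+c$; in particular $P_{1,k}(x,y)=x+\frac1x+y+\frac1y+k$. The (logarithmic) Mahler measure of a nonzero Laurent polynomial $P\in\mathbb{C}[x^{\pm1},y^{\pm1}]$ is $\mathrm{m}(P)=\int_0^1\int_0^1\log|P(e^{2\pi i\theta_1},e^{2\pi i\theta_2})|\,d\theta_1\,d\theta_2$. Square roots are principal branches, so for $k>4$ one has $a=i\sqrt{(k+4)/(k-4)}$ and $c=-ik/\sqrt{k-4}$. *)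

theory Defs
  imports "HOL-Analysis.Analysis" "HOL-Library.Poly_Mapping"
begin

text \<open>
  The coefficient of the monomial \<open>x powi i * y powi j\<close> is the value at \<open>(i, j)\<close>.
\<close>
type_synonym laurent2 = "(int \<times> int) \<Rightarrow>\<^sub>0 complex"

definition laurent2_eval :: "laurent2 \<Rightarrow> complex \<Rightarrow> complex \<Rightarrow> complex" where
  "laurent2_eval P x y =
     (\<Sum>(i, j)\<in>Poly_Mapping.keys P. Poly_Mapping.lookup P (i, j) * x powi i * y powi j)"

definition P_fam :: "complex \<Rightarrow> complex \<Rightarrow> laurent2" where
  "P_fam a c =
     Poly_Mapping.single (1, 0) a + Poly_Mapping.single (-1, 0) a
     + Poly_Mapping.single (0, 1) 1 + Poly_Mapping.single (0, -1) 1
     + Poly_Mapping.single (0, 0) c"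

text \<open>
  Meaningful for \<open>P \<noteq> 0\<close>.  Isabelle's \<open>ln 0 = 0\<close> is harmless there, because the zeros of
  \<open>P\<close> on the torus form a null set.
\<close>
definition mahler_measure :: "laurent2 \<Rightarrow> real" where
  "mahler_measure P =
     (LBINT \<theta>1:{0..1}. (LBINT \<theta>2:{0..1}.
        ln (cmod (laurent2_eval P
          (exp (2 * of_real pi * \<i> * of_real \<theta>1))
          (exp (2 * of_real pi * \<i> * of_real \<theta>2))))))"

lemma laurent2_eval_superset:
  assumes "finite S" "Poly_Mapping.keys P \<subseteq> S"
  shows "laurent2_eval P x y = (\<Sum>(i, j)\<in>S. Poly_Mapping.lookup P (i, j) * x powi i * y powi j)"
  unfolding laurent2_eval_def
  by (rule sum.mono_neutral_left) (use assms in \<open>auto simp: in_keys_iff\<close>)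

lemma laurent2_eval_P_fam:
  "laurent2_eval (P_fam a c) x y = a * (x + 1 / x) + y + 1 / y + c"
proof -
  let ?S = "{(1, 0), (-1, 0), (0, 1), (0, -1), (0, 0)} :: (int \<times> int) set"
  have "Poly_Mapping.keys (P_fam a c) \<subseteq> ?S"
    by (auto simp: P_fam_def in_keys_iff lookup_add lookup_single when_def split: if_splits)
  then have "laurent2_eval (P_fam a c) x y =
      (\<Sum>(i, j)\<in>?S. Poly_Mapping.lookup (P_fam a c) (i, j) * x powi i * y powi j)"
    by (intro laurent2_eval_superset) auto
  also have "\<dots> = a * (x + 1 / x) + y + 1 / y + c"
    by (simp add: P_fam_def lookup_add lookup_single when_def power_int_minus field_simps)
  finally show ?thesis .
qed

end

theory Submission
  imports Defs "HOL-Complex_Analysis.Cauchy_Integral_Formula"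
begin

text \<open>
  Neither polynomial vanishes on the torus; for \<open>P\<^bsub>a,c\<^esub>\<close> this is exactly \<open>k > 2 (1 + sqrt 5)\<close>.
  Substituting \<open>y = Y / x\<close> turns \<open>P\<^bsub>a,c\<^esub>\<close> into \<open>c + p x + q / x\<close> with \<open>p = a + 1 / Y\<close>,
  \<open>q = a + Y\<close>. By Jensen's formula the mean of its log modulus over \<open>x\<close> depends only on \<open>c\<close> and
  \<open>p q = a^2 + 1 + a (Y + 1 / Y)\<close>, and equals half the mean of \<open>log |c^2 - p q z|\<close>, where
  \<open>z = 2 + X + 1 / X\<close> and \<open>X\<close> runs over the circle. Integrating over \<open>Y\<close> first and applying Jensen
  again leaves a single integral over \<open>X\<close>. For the given \<open>a\<close> and \<open>c\<close>, the product of its integrand's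
  arguments at \<open>z\<close> and \<open>4 - z\<close> (that is, at \<open>X\<close> and \<open>- X\<close>) is a perfect square up to a constant,
  and its root is the integrand that Jensen's formula gives for \<open>P\<^bsub>1,k\<^esub>\<close>.
\<close>

section \<open>The unit circle by normalised angle\<close>

text \<open>Spelled as in \<open>mahler_measure\<close>, so that the integrand there matches once
  \<open>circ\<close> is unfolded.\<close>

definition circ :: "real \<Rightarrow> complex" where
  "circ t = exp (2 * of_real pi * \<i> * of_real t)"

lemma circ_eq_cis: "circ t = cis (2 * pi * t)"
  by (simp add: circ_def cis_conv_exp mult_ac)

lemma norm_circ [simp]: "cmod (circ t) = 1"
  by (simp add: circ_eq_cis)

lemma circ_nonzero [simp]: "circ t \<noteq> 0"
  by (simp add: circ_def)

lemma circ_add: "circ (s + t) = circ s * circ t"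
  by (simp add: circ_def ring_distribs exp_add)

lemma circ_1 [simp]: "circ 1 = 1"
  by (simp add: circ_eq_cis)

lemma circ_diff: "circ (s - t) = circ s / circ t"
  by (simp add: circ_def right_diff_distrib exp_diff)

lemma inverse_circ: "1 / circ t = cnj (circ t)"
  by (simp add: circ_eq_cis cis_inverse divide_inverse flip: cis_cnj)

lemma circ_plus_inverse: "circ t + 1 / circ t = of_real (2 * cos (2 * pi * t))"
  by (simp add: inverse_circ complex_add_cnj) (simp add: circ_eq_cis)

lemma continuous_on_circ [continuous_intros]:
  "continuous_on S f \<Longrightarrow> continuous_on S (\<lambda>x. circ (f x))"
  unfolding circ_def by (intro continuous_intros)

section \<open>Means of functions of period 1\<close>

text \<open>Rotations preserve the mean. This serves both the substitution y = Y / x and, with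
  \<open>c = 1 / 2\<close>, the pairing of X with - X.\<close>

lemma integral_periodic_shift:
  fixes g :: "real \<Rightarrow> real"
  assumes cont: "continuous_on UNIV g" and per: "\<And>t. g (t + 1) = g t" and c: "0 \<le> c" "c \<le> 1"
  shows "integral {0..1} (\<lambda>t. g (t + c)) = integral {0..1} g"
proof -
  have int: "g integrable_on {a..b}" for a b
    by (rule integrable_continuous_real) (rule continuous_on_subset[OF cont], simp)
  have "integral {0..1} (\<lambda>t. g (t + c)) = integral {c..1 + c} g"
    using integral_shift_Icc_real[of 0 1 g c] by (simp add: comp_def add.commute)
  also have "\<dots> = integral {c..1} g + integral {1..1 + c} g"
    using c by (intro Henstock_Kurzweil_Integration.integral_combine[symmetric] int) auto
  also have "integral {1..1 + c} g = integral {0..c} g"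
    using integral_shift_Icc_real[of 0 c g 1] per by (simp add: comp_def add.commute)
  also have "integral {c..1} g + integral {0..c} g = integral {0..1} g"
    using Henstock_Kurzweil_Integration.integral_combine[OF c int] by simp
  finally show ?thesis .
qed

text \<open>X and X^2 run over the circle with the same distribution. Needed because pairing X with
  - X produces an integrand in the doubled angle.\<close>

lemma integral_periodic_double:
  fixes g :: "real \<Rightarrow> real"
  assumes cont: "continuous_on UNIV g" and per: "\<And>t. g (t + 1) = g t"
  shows "integral {0..1} (\<lambda>t. g (2 * t)) = integral {0..1} g"
proof -
  have int: "g integrable_on {a..b}" for a b
    by (rule integrable_continuous_real) (rule continuous_on_subset[OF cont], simp)
  have "(g has_integral integral {0..2} g) (cbox 0 2)"
    using int by (simp add: has_integral_integral)
  from has_integral_affinity'[OF this, of 2 0]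
  have "((\<lambda>t. g (2 * t)) has_integral integral {0..2} g / 2) {0..1}"
    by simp
  then have "integral {0..1} (\<lambda>t. g (2 * t)) = integral {0..2} g / 2"
    by (rule integral_unique)
  also have "integral {0..2} g = integral {0..1} g + integral {1..2} g"
    by (intro Henstock_Kurzweil_Integration.integral_combine[symmetric] int) auto
  also have "integral {1..2} g = integral {0..1} g"
    using integral_shift_Icc_real[of 0 1 g 1] per by (simp add: comp_def add.commute)
  finally show ?thesis by simp
qed

section \<open>Jensen's formula for linear factors and their products\<close>

lemma one_plus_mult_circ_nonzero:
  assumes "cmod b < 1"
  shows "1 + b * circ t \<noteq> 0"
proof
  assume "1 + b * circ t = 0"
  then have "cmod (b * circ t) = 1"
    by (metis add_eq_0_iff norm_minus_cancel norm_one)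
  with assms show False by (simp add: norm_mult)
qed

text \<open>Mean value property at 0: \<open>1 + b * z\<close> has positive real part on the closed
  disc, so it avoids the branch cut and its \<open>Ln\<close> is holomorphic there, with value Ln 1
  = 0 at the centre. The claim is the real part.\<close>

lemma integral_ln_norm_one_plus:
  assumes "cmod b < 1"
  shows "integral {0..1} (\<lambda>t. ln (cmod (1 + b * circ t))) = 0"
proof -
  have Re_pos: "0 < Re (1 + b * z)" if "z \<in> cball 0 1" for z
  proof -
    have "cmod (b * z) \<le> cmod b * 1"
      unfolding norm_mult using that by (intro mult_left_mono) auto
    then show ?thesis
      using abs_Re_le_cmod[of "b * z"] assms by simp
  qed
  then have notin: "1 + b * z \<notin> \<real>\<^sub>\<le>\<^sub>0" if "z \<in> cball 0 1" for z
    using that complex_nonpos_Reals_iff by (metis not_le)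
  have holo: "(\<lambda>z. Ln (1 + b * z)) holomorphic_on cball 0 1"
    using notin by (intro holomorphic_intros) auto
  have path: "circlepath 0 1 t = circ t" for t
    by (simp add: circlepath circ_def)
  from Cauchy_integral_circlepath_simple[OF holo, of 0]
  have "((\<lambda>u. Ln (1 + b * u) / u) has_contour_integral 0) (circlepath 0 1)"
    by simp
  then have "((\<lambda>t. Ln (1 + b * circlepath 0 1 t) / circlepath 0 1 t *
      vector_derivative (circlepath 0 1) (at t within {0..1})) has_integral 0) {0..1}"
    unfolding has_contour_integral_def .
  moreover have "Ln (1 + b * circlepath 0 1 t) / circlepath 0 1 t *
      vector_derivative (circlepath 0 1) (at t within {0..1}) =
      2 * of_real pi * \<i> * Ln (1 + b * circ t)" if "t \<in> {0..1}" for t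
  proof -
    have "vector_derivative (circlepath 0 1) (at t within {0..1}) = 2 * of_real pi * \<i> * circ t"
      using that by (simp add: vector_derivative_circlepath01 circ_def)
    then show ?thesis
      unfolding path by (simp only:) simp
  qed
  ultimately have "((\<lambda>t. 2 * of_real pi * \<i> * Ln (1 + b * circ t)) has_integral 0) {0..1}"
    by (rule has_integral_eq[rotated])
  from has_integral_mult_right[OF this, of "1 / (2 * of_real pi * \<i>)"]
  have "((\<lambda>t. 1 / (2 * of_real pi * \<i>) * (2 * of_real pi * \<i> * Ln (1 + b * circ t)))
      has_integral 1 / (2 * of_real pi * \<i>) * 0) {0..1}" .
  moreover have "1 / (2 * of_real pi * \<i>) * (2 * of_real pi * \<i> * w) = w" for w :: complex
    by simp
  ultimately have "((\<lambda>t. Ln (1 + b * circ t)) has_integral 0) {0..1}"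
    by (simp only: mult_zero_right)
  from has_integral_Re[OF this] have "((\<lambda>t. Re (Ln (1 + b * circ t))) has_integral 0) {0..1}"
    by simp
  moreover have "Re (Ln (1 + b * circ t)) = ln (cmod (1 + b * circ t))" for t
    using one_plus_mult_circ_nonzero[OF assms] by simp
  ultimately show ?thesis
    by (simp add: integral_unique)
qed

text \<open>
  Jensen's formula when one root of \<open>p X^2 + c X + q\<close> lies on each side of the unit circle: then
  \<open>c = C + p q / C\<close> and the polynomial factors as \<open>C (1 + (p / C) X) (X + q / C)\<close>.
\<close>
lemma integral_ln_norm_factored:
  assumes p: "cmod p < cmod C" and q: "cmod q < cmod C"
  shows "integral {0..1} (\<lambda>t. ln (cmod (C + p * q / C + p * circ t + q / circ t))) = ln (cmod C)"
proof -
  have C: "C \<noteq> 0" using p by auto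
  \<comment> \<open>On the circle 1 / X is the conjugate of X. With the conjugate in
    \<open>d\<close>, the factor 1 + (q / C) / X has the modulus of 1 + d X, so one lemma covers
    both factors.\<close>
  define b d where "b = p / C" and "d = cnj (q / C)"
  have b: "cmod b < 1" and d: "cmod d < 1"
    using p q C by (simp_all add: b_def d_def norm_divide)
  have fact: "C + p * q / C + p * circ t + q / circ t = C * (1 + b * circ t) * cnj (1 + d * circ t)" for t
    using C by (simp add: b_def d_def field_simps flip: inverse_circ)
  have "ln (cmod (C + p * q / C + p * circ t + q / circ t)) =
      ln (cmod C) + (ln (cmod (1 + b * circ t)) + ln (cmod (1 + d * circ t)))" for t
    unfolding fact norm_mult complex_mod_cnj
    using C one_plus_mult_circ_nonzero[OF b, of t] one_plus_mult_circ_nonzero[OF d, of t]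
    by (simp add: ln_mult)
  moreover have "((\<lambda>t. ln (cmod (1 + b * circ t))) has_integral 0) {0..1}" if "cmod b < 1" for b
  proof -
    have "(\<lambda>t. ln (cmod (1 + b * circ t))) integrable_on {0..1}"
      using one_plus_mult_circ_nonzero[OF that]
      by (intro integrable_continuous_real continuous_intros) auto
    from integrable_integral[OF this] show ?thesis
      by (simp only: integral_ln_norm_one_plus[OF that])
  qed
  from has_integral_add[OF has_integral_const_real[of "ln (cmod C)" 0 1]
      has_integral_add[OF this[OF b] this[OF d]]]
  have "((\<lambda>t. ln (cmod C) + (ln (cmod (1 + b * circ t)) + ln (cmod (1 + d * circ t))))
      has_integral ln (cmod C)) {0..1}"
    by simp
  ultimately show ?thesis
    by (simp only: integral_unique)
qed

section \<open>Reduction of both Mahler measures to single integrals\<close>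

text \<open>The substitution y = Y / x, with Y as outer and x as inner variable. Nonvanishing on the
  torus makes the integrand continuous, which justifies passing to gauge integrals and exchanging
  their order.\<close>

lemma mahler_measure_P_fam:
  assumes nz: "\<And>x y. cmod x = 1 \<Longrightarrow> cmod y = 1 \<Longrightarrow> a * (x + 1 / x) + y + 1 / y + c \<noteq> 0"
  shows "mahler_measure (P_fam a c) = integral {0..1} (\<lambda>s. integral {0..1} (\<lambda>t.
    ln (cmod (c + (a + 1 / circ s) * circ t + (a + circ s) / circ t))))"
proof -
  define f where "f s t = ln (cmod (a * (circ s + 1 / circ s) + circ t + 1 / circ t + c))" for s t
  have nz': "a * (circ s + 1 / circ s) + circ t + 1 / circ t + c \<noteq> 0" for s t
    by (rule nz) auto
  have cont: "continuous_on S (\<lambda>p. f (u p) (v p))"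
    if "continuous_on S u" "continuous_on S v" for S and u v :: "'x::topological_space \<Rightarrow> real"
    unfolding f_def using nz' by (intro continuous_intros that) auto
  have inner: "(LBINT t:{0..1}. f s t) = integral {0..1} (f s)" for s
    by (intro set_borel_integral_eq_integral(2) borel_integrable_atLeastAtMost' cont continuous_intros)
  have "continuous_on {0..1} (\<lambda>s. integral (cbox 0 1) (f s))"
    by (rule integral_continuous_on_param) (unfold case_prod_unfold, intro cont continuous_intros)
  then have "mahler_measure (P_fam a c) = integral {0..1} (\<lambda>s. integral {0..1} (f s))"
    unfolding mahler_measure_def laurent2_eval_P_fam
    unfolding f_def[symmetric, unfolded circ_def] inner
    by (intro set_borel_integral_eq_integral(2) borel_integrable_atLeastAtMost') simp
  also have "\<dots> = integral {0..1} (\<lambda>s. integral {0..1} (\<lambda>t. f s (t - s)))"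
  proof (rule integral_cong)
    fix s :: real assume s: "s \<in> {0..1}"
    have per: "f s (t + 1) = f s t" for t
      by (simp add: f_def circ_add)
    \<comment> \<open>The shift lemma takes amounts in [0, 1], so - s is replaced by 1 - s.\<close>
    have "f s (t - s) = f s (t + (1 - s))" for t
    proof -
      have "t + (1 - s) = t - s + 1" by simp
      then show ?thesis by (simp only: per)
    qed
    then have "integral {0..1} (\<lambda>t. f s (t - s)) = integral {0..1} (\<lambda>t. f s (t + (1 - s)))"
      by (simp only:)
    also have "\<dots> = integral {0..1} (f s)"
      using s by (intro integral_periodic_shift[of "f s", OF _ per] cont continuous_intros) auto
    finally show "integral {0..1} (f s) = integral {0..1} (\<lambda>t. f s (t - s))" ..
  qed
  also have "\<dots> = integral {0..1} (\<lambda>t. integral {0..1} (\<lambda>s. f s (t - s)))"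
  proof -
    have "continuous_on (cbox (0, 0) (1, 1)) (\<lambda>(s, t). f s (t - s))"
      unfolding case_prod_unfold by (intro cont continuous_intros)
    from integral_swap_continuous[OF this] show ?thesis
      by simp
  qed
  also have "(\<lambda>t s. f s (t - s)) = (\<lambda>t s.
      ln (cmod (c + (a + 1 / circ t) * circ s + (a + circ t) / circ s)))"
  proof (intro ext)
    fix t s
    have "a * (circ s + 1 / circ s) + circ (t - s) + 1 / circ (t - s) + c =
        c + (a + 1 / circ t) * circ s + (a + circ t) / circ s"
      unfolding circ_diff by (simp add: ring_distribs add_divide_distrib)
    then show "f s (t - s) = ln (cmod (c + (a + 1 / circ t) * circ s + (a + circ t) / circ s))"
      by (simp only: f_def)
  qed
  finally show ?thesis .
qed

text \<open>Three uses of Jensen's formula: over x, backwards to introduce X, then over Y. The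
  radicand is the discriminant of C^2 - A C - B^2 with B = \<alpha> z, whose positive root is the
  argument of \<open>ln\<close>.\<close>

lemma mahler_measure_P_fam_imaginary:
  fixes \<alpha> \<gamma> :: real
  assumes \<alpha>: "0 \<le> \<alpha>" and \<gamma>: "2 * \<alpha> < \<gamma>"
  defines "z \<equiv> \<lambda>t. 2 + 2 * cos (2 * pi * t)"
  defines "A \<equiv> \<lambda>t. \<gamma>\<^sup>2 + (1 - \<alpha>\<^sup>2) * z t"
  shows "2 * mahler_measure (P_fam (\<i> * of_real \<alpha>) (- \<i> * of_real \<gamma>)) =
    integral {0..1} (\<lambda>t. ln ((A t + sqrt ((A t)\<^sup>2 + (2 * \<alpha> * z t)\<^sup>2)) / 2))"
proof -
  define a where "a = \<i> * complex_of_real \<alpha>"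
  define r where "r s = a\<^sup>2 + 1 + a * (circ s + 1 / circ s)" for s
  \<comment> \<open>\<open>D s\<close> and \<gamma> - \<open>D s\<close> are the roots of T^2 -
    \<gamma> T - r; \<open>D s\<close> is the larger in modulus.\<close>
  define D where "D s = of_real \<gamma> / 2 + csqrt (of_real (\<gamma>\<^sup>2) + 4 * r s) / 2" for s
  have r: "r s = of_real (1 - \<alpha>\<^sup>2) + \<i> * of_real (2 * \<alpha> * cos (2 * pi * s))" for s
    by (simp add: r_def a_def circ_plus_inverse power_mult_distrib algebra_simps)
  have "\<gamma> > 0" and "\<gamma>\<^sup>2 > 4 * \<alpha>\<^sup>2"
    using \<alpha> \<gamma> power_strict_mono[of "2 * \<alpha>" \<gamma> 2] by (auto simp: power_mult_distrib)
  have z: "0 \<le> z t" "z t \<le> 4" for t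
    using cos_ge_minus_one[of "2 * pi * t"] cos_le_one[of "2 * pi * t"]
    unfolding z_def by linarith+
  have A_pos: "A t > 0" for t
  proof -
    have "\<alpha>\<^sup>2 * z t \<le> \<alpha>\<^sup>2 * 4"
      using z by (intro mult_left_mono) auto
    then show ?thesis
      using \<open>\<gamma>\<^sup>2 > 4 * \<alpha>\<^sup>2\<close> z(1)[of t] by (simp add: A_def algebra_simps power2_eq_square)
  qed
  \<comment> \<open>The square of the root has real part \<gamma>^2 + 4 - 4 \<alpha>^2 > 4. The
    bound 2 gives Re D > 1 + \<alpha>, which dominates the coefficients p and q.\<close>
  have Re_sqrt: "Re (csqrt (of_real (\<gamma>\<^sup>2) + 4 * r s)) \<ge> 2" for s
  proof -
    let ?W = "csqrt (of_real (\<gamma>\<^sup>2) + 4 * r s)"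
    have "(Re ?W)\<^sup>2 - (Im ?W)\<^sup>2 = Re (?W\<^sup>2)"
      by (simp only: Re_power2)
    also have "\<dots> = \<gamma>\<^sup>2 + 4 * (1 - \<alpha>\<^sup>2)"
      by (simp add: r)
    finally have "(Re ?W)\<^sup>2 \<ge> 4"
      using \<open>\<gamma>\<^sup>2 > 4 * \<alpha>\<^sup>2\<close> zero_le_power2[of "Im ?W"] by argo
    then have "2\<^sup>2 \<le> (Re ?W)\<^sup>2"
      by (simp del: csqrt.sel)
    then show ?thesis
      using Re_csqrt by (rule power2_le_imp_le)
  qed
  have r_factor: "r s = D s * (D s - of_real \<gamma>)" for s
  proof -
    have "2 * D s - of_real \<gamma> = csqrt (of_real (\<gamma>\<^sup>2) + 4 * r s)"
      by (simp add: D_def)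
    then have "(2 * D s - of_real \<gamma>)\<^sup>2 = of_real (\<gamma>\<^sup>2) + 4 * r s"
      by simp
    then have "4 * r s = 4 * (D s * (D s - of_real \<gamma>))"
      by (simp add: power2_eq_square algebra_simps)
    then show ?thesis
      by (simp only: mult_cancel_left) simp
  qed
  have D_gt: "1 + \<alpha> < Re (D s)" for s
    using Re_sqrt[of s] \<gamma> by (simp add: D_def del: csqrt.sel)
  have D_norm_gt: "1 + \<alpha> < cmod (D s)" for s
    using D_gt[of s] complex_Re_le_cmod[of "D s"] by linarith
  have D_nz: "D s \<noteq> 0" for s
    using D_norm_gt[of s] \<alpha> by auto
  \<comment> \<open>Re D > \<gamma> / 2 puts D farther from 0 than from \<gamma>, so |r| = |D| |D -
    \<gamma>| < |D|^2. This admits the second use of Jensen's formula.\<close>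
  have r_less: "cmod (r s) < cmod ((D s)\<^sup>2)" for s
  proof -
    have "\<gamma> < 2 * Re (D s)"
      using Re_sqrt[of s] by (simp add: D_def del: csqrt.sel)
    then have "0 < \<gamma> * (2 * Re (D s) - \<gamma>)"
      using \<open>\<gamma> > 0\<close> by simp
    then have "(Re (D s) - \<gamma>)\<^sup>2 < (Re (D s))\<^sup>2"
      by (simp add: power2_eq_square algebra_simps)
    then have "cmod (D s - of_real \<gamma>) < cmod (D s)"
      by (simp add: cmod_def)
    then show ?thesis
      using D_nz[of s] by (simp add: r_factor norm_mult power2_eq_square)
  qed
  have "mahler_measure (P_fam a (- \<i> * of_real \<gamma>)) =
      integral {0..1} (\<lambda>s. integral {0..1} (\<lambda>t.
        ln (cmod (- \<i> * of_real \<gamma> + (a + 1 / circ s) * circ t + (a + circ s) / circ t))))"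
  proof (rule mahler_measure_P_fam)
    fix x y :: complex assume xy: "cmod x = 1" "cmod y = 1"
    have inv: "1 / u = cnj u" if "cmod u = 1" for u
      using that by (simp add: divide_conv_cnj)
    \<comment> \<open>On the torus y + 1 / y is real, so the imaginary part alone excludes
      zeros.\<close>
    have "Im (a * (x + 1 / x) + y + 1 / y + - \<i> * of_real \<gamma>) = 2 * \<alpha> * Re x - \<gamma>"
      by (simp add: inv xy a_def)
    also have "\<dots> \<le> 2 * \<alpha> * 1 - \<gamma>"
      using \<alpha> complex_Re_le_cmod[of x] xy by (intro diff_right_mono mult_left_mono) auto
    also have "\<dots> < 0"
      using \<gamma> by simp
    finally show "a * (x + 1 / x) + y + 1 / y + - \<i> * of_real \<gamma> \<noteq> 0"
      by (metis less_irrefl zero_complex.sel(2))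
  qed
  also have "\<dots> = integral {0..1} (\<lambda>s. ln (cmod (D s)))"
  proof (intro integral_cong)
    fix s :: real
    define p q where "p = a + 1 / circ s" and "q = a + circ s"
    have pq: "p * q = r s"
      by (simp add: p_def q_def r_def power2_eq_square algebra_simps add_divide_distrib)
    have C: "- \<i> * D s + p * q / (- \<i> * D s) = - \<i> * of_real \<gamma>"
      using D_nz[of s] by (simp add: pq r_factor field_simps)
    have "cmod p \<le> 1 + \<alpha>" "cmod q \<le> 1 + \<alpha>"
      using \<alpha> norm_triangle_ineq[of a "1 / circ s"] norm_triangle_ineq[of a "circ s"]
      by (simp_all add: p_def q_def a_def norm_mult norm_divide)
    then show "integral {0..1} (\<lambda>t.
          ln (cmod (- \<i> * of_real \<gamma> + (a + 1 / circ s) * circ t + (a + circ s) / circ t))) =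
        ln (cmod (D s))"
      using integral_ln_norm_factored[of p "- \<i> * D s" q] D_norm_gt[of s]
      unfolding C by (simp add: p_def q_def norm_mult)
  qed
  also have "2 * \<dots> = integral {0..1} (\<lambda>s. ln (cmod ((D s)\<^sup>2)))"
    using D_nz by (simp add: norm_power ln_realpow)
  \<comment> \<open>Jensen's formula backwards, with D^2 as leading constant and r as both
    coefficients: D^2 + (D - \<gamma>)^2 = \<gamma>^2 + 2 r.\<close>
  also have "\<dots> = integral {0..1} (\<lambda>s. integral {0..1} (\<lambda>t. ln (cmod (of_real (\<gamma>\<^sup>2) + r s * of_real (z t)))))"
  proof (intro integral_cong)
    fix s :: real
    have "(D s)\<^sup>2 + r s * r s / (D s)\<^sup>2 = of_real (\<gamma>\<^sup>2) + 2 * r s"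
      using D_nz[of s] by (simp add: r_factor power2_eq_square field_simps)
    moreover have "of_real (\<gamma>\<^sup>2) + 2 * r s + r s * circ t + r s / circ t = of_real (\<gamma>\<^sup>2) + r s * of_real (z t)" for t
    proof -
      have "of_real (\<gamma>\<^sup>2) + 2 * r s + r s * circ t + r s / circ t = of_real (\<gamma>\<^sup>2) + r s * (2 + (circ t + 1 / circ t))"
        by (simp add: algebra_simps)
      then show ?thesis by (simp add: circ_plus_inverse z_def)
    qed
    ultimately show "ln (cmod ((D s)\<^sup>2)) = integral {0..1} (\<lambda>t. ln (cmod (of_real (\<gamma>\<^sup>2) + r s * of_real (z t))))"
      using integral_ln_norm_factored[OF r_less r_less, of s] by (simp only:)
  qed
  also have "\<dots> = integral {0..1} (\<lambda>t. integral {0..1} (\<lambda>s. ln (cmod (of_real (\<gamma>\<^sup>2) + r s * of_real (z t)))))"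
  proof -
    \<comment> \<open>The real part does not depend on s and is positive, so the integrand is
      continuous and the order may be exchanged.\<close>
    have "Re (of_real (\<gamma>\<^sup>2) + r s * of_real (z t)) = A t" for s t
      by (simp add: r A_def)
    then have "of_real (\<gamma>\<^sup>2) + r s * of_real (z t) \<noteq> 0" for s t
      using A_pos[of t] by (metis less_irrefl zero_complex.sel(1))
    then have "continuous_on (cbox (0, 0) (1, 1)) (\<lambda>(s, t). ln (cmod (of_real (\<gamma>\<^sup>2) + r s * of_real (z t))))"
      unfolding case_prod_unfold r_def z_def by (intro continuous_intros) auto
    from integral_swap_continuous[OF this] show ?thesis
      by simp
  qed
  also have "\<dots> = integral {0..1} (\<lambda>t. ln ((A t + sqrt ((A t)\<^sup>2 + (2 * \<alpha> * z t)\<^sup>2)) / 2))"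
  proof (intro integral_cong)
    fix t :: real
    \<comment> \<open>In Y the expression is A + i B (Y + 1 / Y), so Jensen's formula applies with
      both coefficients i B; C - B^2 / C = A determines C.\<close>
    define B where "B = \<alpha> * z t"
    define C where "C = (A t + sqrt ((A t)\<^sup>2 + (2 * B)\<^sup>2)) / 2"
    have "0 \<le> B"
      using \<alpha> z by (simp add: B_def)
    have "2 * B \<le> sqrt ((A t)\<^sup>2 + (2 * B)\<^sup>2)"
      by (rule real_le_rsqrt) simp
    then have "B < C"
      using A_pos[of t] by (simp add: C_def)
    have "2 * C - A t = sqrt ((A t)\<^sup>2 + (2 * B)\<^sup>2)"
      by (simp add: C_def add_divide_distrib)
    then have "(2 * C - A t)\<^sup>2 = (A t)\<^sup>2 + (2 * B)\<^sup>2"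
      by simp
    then have "B * B = C * (C - A t)"
      by (simp add: power2_eq_square algebra_simps)
    then have "C - B * B / C = A t"
      using \<open>0 \<le> B\<close> \<open>B < C\<close> by simp
    then have "complex_of_real (C - B * B / C) = of_real (A t)"
      by simp
    moreover have "(\<i> * of_real B) * (\<i> * of_real B) = complex_of_real (- (B * B))"
      by (simp add: complex_eq_iff)
    ultimately have CA: "of_real C + (\<i> * of_real B) * (\<i> * of_real B) / of_real C = complex_of_real (A t)"
      by simp
    have "of_real (\<gamma>\<^sup>2) + r s * of_real (z t) =
        of_real (A t) + \<i> * of_real B * circ s + \<i> * of_real B / circ s" for s
    proof -
      have "of_real (A t) + \<i> * of_real B * circ s + \<i> * of_real B / circ s =
          of_real (A t) + \<i> * of_real B * (circ s + 1 / circ s)"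
        by (simp add: algebra_simps)
      then show ?thesis
        by (simp add: circ_plus_inverse r A_def B_def algebra_simps)
    qed
    then have "integral {0..1} (\<lambda>s. ln (cmod (of_real (\<gamma>\<^sup>2) + r s * of_real (z t)))) = ln C"
      using integral_ln_norm_factored[of "\<i> * of_real B" "of_real C" "\<i> * of_real B"]
        \<open>0 \<le> B\<close> \<open>B < C\<close> unfolding CA by (simp add: norm_mult)
    then show "integral {0..1} (\<lambda>s. ln (cmod (of_real (\<gamma>\<^sup>2) + r s * of_real (z t)))) =
        ln ((A t + sqrt ((A t)\<^sup>2 + (2 * \<alpha> * z t)\<^sup>2)) / 2)"
      by (simp add: C_def B_def mult.assoc)
  qed
  finally show ?thesis
    by (simp add: a_def)
qed

text \<open>Here p q = 2 + Y + 1 / Y is real, so one use of Jensen's formula suffices: C is the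
  larger root of C^2 - k C + p q. From k > 4 follows C > 2, and |p|, |q| are at most 2.\<close>

lemma mahler_measure_P_fam_1:
  fixes k :: real
  assumes k: "k > 4"
  shows "mahler_measure (P_fam 1 (of_real k)) =
    integral {0..1} (\<lambda>t. ln ((k + sqrt (k\<^sup>2 - 8 * (1 + cos (2 * pi * t)))) / 2))"
proof -
  have "mahler_measure (P_fam 1 (of_real k)) =
      integral {0..1} (\<lambda>s. integral {0..1} (\<lambda>t.
        ln (cmod (of_real k + (1 + 1 / circ s) * circ t + (1 + circ s) / circ t))))"
  proof (rule mahler_measure_P_fam)
    fix x y :: complex assume xy: "cmod x = 1" "cmod y = 1"
    have inv: "1 / u = cnj u" if "cmod u = 1" for u
      using that by (simp add: divide_conv_cnj)
    have "0 < 2 * Re x + 2 * Re y + k"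
      using k abs_Re_le_cmod[of x] abs_Re_le_cmod[of y] xy by linarith
    also have "\<dots> = Re (1 * (x + 1 / x) + y + 1 / y + of_real k)"
      by (simp add: inv xy)
    finally show "1 * (x + 1 / x) + y + 1 / y + of_real k \<noteq> 0"
      by (metis less_irrefl zero_complex.sel(1))
  qed
  also have "\<dots> = integral {0..1} (\<lambda>t. ln ((k + sqrt (k\<^sup>2 - 8 * (1 + cos (2 * pi * t)))) / 2))"
  proof (intro integral_cong)
    fix s :: real
    define p q where "p = 1 + 1 / circ s" and "q = 1 + circ s"
    define \<rho> where "\<rho> = 2 * (1 + cos (2 * pi * s))"
    define C where "C = (k + sqrt (k\<^sup>2 - 8 * (1 + cos (2 * pi * s)))) / 2"
    have "p * q = 2 + (circ s + 1 / circ s)"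
      by (simp add: p_def q_def algebra_simps add_divide_distrib)
    then have pq: "p * q = of_real \<rho>"
      by (simp add: circ_plus_inverse \<rho>_def)
    have "4\<^sup>2 < k\<^sup>2"
      using k by (intro power_strict_mono) auto
    then have rad: "0 < k\<^sup>2 - 8 * (1 + cos (2 * pi * s))"
      using cos_le_one[of "2 * pi * s"] by (simp only: power2_eq_square) argo
    from real_sqrt_gt_zero[OF this] have C: "C > 2"
      using k unfolding C_def by argo
    have "2 * C - k = sqrt (k\<^sup>2 - 4 * \<rho>)"
      by (simp add: C_def \<rho>_def add_divide_distrib)
    then have "(2 * C - k)\<^sup>2 = k\<^sup>2 - 4 * \<rho>"
      using rad by (simp add: \<rho>_def)
    then have "\<rho> = C * (k - C)"
      by (simp add: power2_eq_square algebra_simps)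
    then have "C + \<rho> / C = k"
      using C by simp
    then have Ck: "of_real C + p * q / of_real C = complex_of_real k"
      unfolding pq by (metis of_real_add of_real_divide)
    have "cmod p \<le> 2" "cmod q \<le> 2"
      using norm_triangle_ineq[of 1 "1 / circ s"] norm_triangle_ineq[of 1 "circ s"]
      by (simp_all add: p_def q_def norm_divide)
    then show "integral {0..1} (\<lambda>t.
          ln (cmod (of_real k + (1 + 1 / circ s) * circ t + (1 + circ s) / circ t))) = ln C"
      using integral_ln_norm_factored[of p "of_real C" q] C
      unfolding Ck by (simp add: p_def q_def)
  qed
  finally show ?thesis .
qed

section \<open>Comparison of the two single integrals by pairing X with - X\<close>

theorem corollary2:
  fixes k :: real and a c :: complex
  assumes "k > 2 * (1 + sqrt 5)"
    and "a = csqrt (of_real ((4 + k) / (4 - k)))"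
    and "c = of_real k / csqrt (of_real (4 - k))"
  shows "mahler_measure (P_fam 1 (of_real k)) =
    2 * mahler_measure (P_fam a c) + 1 / 2 * ln ((k - 4) / (k + 4))"
proof -
  define \<alpha> where "\<alpha> = sqrt ((k + 4) / (k - 4))"
  define \<gamma> where "\<gamma> = k / sqrt (k - 4)"
  define z where "z t = 2 + 2 * cos (2 * pi * t)" for t
  define A where "A t = \<gamma>\<^sup>2 + (1 - \<alpha>\<^sup>2) * z t" for t
  define R where "R t = sqrt (k\<^sup>2 - 4 * (z t * (4 - z t)))" for t
  define h where "h t = ln ((A t + sqrt ((A t)\<^sup>2 + (2 * \<alpha> * z t)\<^sup>2)) / 2)" for t
  define g where "g t = ln ((k + sqrt (k\<^sup>2 - 8 * (1 + cos (2 * pi * t)))) / 2)" for t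
  have "sqrt 5 > 2"
    by (rule real_less_rsqrt) simp
  then have k: "k > 6"
    using assms(1) by simp
  \<comment> \<open>Completing the square turns the hypothesis into k^2 > 4 (k + 4), which is 2
    \<alpha> < \<gamma> squared and multiplied by k - 4.\<close>
  have "(2 * sqrt 5)\<^sup>2 < (k - 2)\<^sup>2"
    using assms(1) by (intro power_strict_mono) auto
  then have k_sq: "4 * (k + 4) < k\<^sup>2"
    by (simp add: power2_eq_square algebra_simps)
  have "6 * 6 < k * k"
    using k by (intro mult_strict_mono) auto
  then have k_sq36: "36 < k\<^sup>2"
    by (simp add: power2_eq_square)
  have \<alpha>_sq: "\<alpha>\<^sup>2 = (k + 4) / (k - 4)" and \<gamma>_sq: "\<gamma>\<^sup>2 = k\<^sup>2 / (k - 4)"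
    using k by (simp_all add: \<alpha>_def \<gamma>_def power_divide)
  have "\<alpha> > 0" "\<gamma> > 0"
    using k by (simp_all add: \<alpha>_def \<gamma>_def)
  have "2 * \<alpha> < \<gamma>"
  proof (rule power2_less_imp_less)
    show "(2 * \<alpha>)\<^sup>2 < \<gamma>\<^sup>2"
      using k k_sq by (simp add: power_mult_distrib \<alpha>_sq \<gamma>_sq divide_strict_right_mono)
  qed (use \<open>\<gamma> > 0\<close> in simp)
  have "(4 + k) / (4 - k) = - ((k + 4) / (k - 4))"
    using k by (simp add: field_simps)
  then have a: "a = \<i> * of_real \<alpha>"
    using k by (simp add: assms(2) \<alpha>_def)
  have "csqrt (of_real (4 - k)) = \<i> * of_real (sqrt (k - 4))"
    using k by simp
  then have "c = of_real k / (\<i> * of_real (sqrt (k - 4)))"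
    by (simp only: assms(3))
  then have c: "c = - \<i> * of_real \<gamma>"
    by (simp add: \<gamma>_def divide_inverse)
  have z: "0 \<le> z t" "z t \<le> 4" for t
    using cos_ge_minus_one[of "2 * pi * t"] cos_le_one[of "2 * pi * t"]
    unfolding z_def by linarith+
  \<comment> \<open>Half a turn sends X to - X.\<close>
  have z_shift: "z (t + 1 / 2) = 4 - z t" for t
    by (simp add: z_def ring_distribs)
  have R_sq: "(R t)\<^sup>2 = k\<^sup>2 - 4 * (z t * (4 - z t))" and R_nonneg: "R t \<ge> 0" for t
  proof -
    have "0 \<le> (z t - 2)\<^sup>2"
      by simp
    then have "4 * (z t * (4 - z t)) \<le> 16"
      by (simp add: power2_eq_square algebra_simps)
    then have "0 \<le> k\<^sup>2 - 4 * (z t * (4 - z t))"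
      using k_sq36 by linarith
    then show "(R t)\<^sup>2 = k\<^sup>2 - 4 * (z t * (4 - z t))" "R t \<ge> 0"
      by (simp_all add: R_def)
  qed
  have R_shift: "R (t + 1 / 2) = R t" for t
    by (simp add: R_def z_shift mult.commute)
  have pos: "k\<^sup>2 - 8 * z t + k * R t > 0" for t
  proof -
    have "k * R t \<ge> 0"
      using k R_nonneg by simp
    then show ?thesis
      using k_sq36 z(2)[of t] by linarith
  qed
  have h_eq: "h t = ln ((k\<^sup>2 - 8 * z t + k * R t) / (2 * (k - 4)))" for t
  proof -
    have A: "A t = (k\<^sup>2 - 8 * z t) / (k - 4)"
    proof -
      have "1 - \<alpha>\<^sup>2 = - 8 / (k - 4)"
        using k by (simp add: \<alpha>_sq field_simps)
      then show ?thesis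
        by (simp add: A_def \<gamma>_sq diff_divide_distrib)
    qed
    have "(A t)\<^sup>2 + (2 * \<alpha> * z t)\<^sup>2 = ((k\<^sup>2 - 8 * z t)\<^sup>2 + 4 * (k + 4) * (k - 4) * (z t)\<^sup>2) / (k - 4)\<^sup>2"
    proof -
      have "\<alpha>\<^sup>2 = (k + 4) * (k - 4) / (k - 4)\<^sup>2"
        unfolding \<alpha>_sq using k by (simp add: power2_eq_square)
      then show ?thesis
        by (simp add: A power_mult_distrib power_divide add_divide_distrib)
    qed
    \<comment> \<open>The terms 64 z^2 cancel, leaving k^2 times k^2 - 16 z + 4 z^2, which is
      symmetric under z -> 4 - z.\<close>
    also have "\<dots> = (k * R t / (k - 4))\<^sup>2"
      unfolding power_divide power_mult_distrib R_sq by (simp add: power2_eq_square algebra_simps)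
    finally have "sqrt ((A t)\<^sup>2 + (2 * \<alpha> * z t)\<^sup>2) = k * R t / (k - 4)"
      using k R_nonneg[of t] by simp
    then show ?thesis
      by (simp add: h_def A flip: add_divide_distrib) (simp add: mult.commute)
  qed
  have h_cont: "continuous_on S h" for S
  proof -
    have "(k\<^sup>2 - 8 * z t + k * R t) / (2 * (k - 4)) \<noteq> 0" for t
      using pos[of t] k by simp
    then show ?thesis
      unfolding h_eq[abs_def] unfolding R_def z_def using k by (intro continuous_intros) auto
  qed
  have h_sum: "h t + h (t + 1 / 2) = 2 * ln \<alpha> + 2 * ln ((k + R t) / 2)" for t
  proof -
    define u where "u = k\<^sup>2 - 8 * z t + k * R t"
    define v where "v = k\<^sup>2 - 8 * (4 - z t) + k * R t"
    \<comment> \<open>The perfect square: the difference vanishes by the definition of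
      \<open>R\<close>. The constant k^2 - 16, over (k - 4)^2, becomes \<alpha>^2, the source of the
      logarithmic term.\<close>
    have "u * v - (k\<^sup>2 - 16) * (k + R t)\<^sup>2 = 16 * ((R t)\<^sup>2 - (k\<^sup>2 - 4 * (z t * (4 - z t))))"
      unfolding u_def v_def by (simp add: power2_eq_square algebra_simps)
    then have uv: "u * v = (k\<^sup>2 - 16) * (k + R t)\<^sup>2"
      by (simp add: R_sq)
    have "u > 0" "v > 0"
      using pos[of t] pos[of "t + 1 / 2"] by (simp_all only: u_def v_def z_shift R_shift)
    then have "h t + h (t + 1 / 2) = ln (u / (2 * (k - 4)) * (v / (2 * (k - 4))))"
      unfolding h_eq z_shift R_shift u_def[symmetric] v_def[symmetric] using k
      by (intro ln_mult_pos[symmetric]) simp_all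
    also have "u / (2 * (k - 4)) * (v / (2 * (k - 4))) = (k\<^sup>2 - 16) / (k - 4)\<^sup>2 * ((k + R t) / 2)\<^sup>2"
      by (simp only: times_divide_times_eq uv power_divide) (simp add: power2_eq_square algebra_simps)
    also have "(k\<^sup>2 - 16) / (k - 4)\<^sup>2 = \<alpha>\<^sup>2"
    proof -
      have "k\<^sup>2 - 16 = (k + 4) * (k - 4)"
        by (simp add: power2_eq_square algebra_simps)
      then show ?thesis
        unfolding \<alpha>_sq using k by (simp add: power2_eq_square)
    qed
    also have "ln (\<alpha>\<^sup>2 * ((k + R t) / 2)\<^sup>2) = 2 * ln \<alpha> + 2 * ln ((k + R t) / 2)"
    proof -
      have "(k + R t) / 2 > 0"
        using k R_nonneg[of t] by simp
      then show ?thesis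
        using \<open>\<alpha> > 0\<close> by (simp add: ln_mult_pos ln_realpow)
    qed
    finally show ?thesis .
  qed
  \<comment> \<open>4 z (4 - z) = 16 sin^2 (2 pi t) = 8 (1 - cos (4 pi t)); the extra 1 / 2 turns
    the minus sign into the plus sign in \<open>g\<close>.\<close>
  have R_double: "R t = sqrt (k\<^sup>2 - 8 * (1 + cos (2 * pi * (2 * t + 1 / 2))))" for t
  proof -
    have "cos (2 * pi * (2 * t + 1 / 2)) = - cos (2 * (2 * pi * t))"
      by (simp add: ring_distribs mult_ac)
    also have "\<dots> = 1 - 2 * (cos (2 * pi * t))\<^sup>2"
      by (simp only: cos_double_cos minus_diff_eq)
    finally have "4 * (z t * (4 - z t)) = 8 * (1 + cos (2 * pi * (2 * t + 1 / 2)))"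
      by (simp add: z_def power2_eq_square algebra_simps)
    then show ?thesis
      by (simp only: R_def)
  qed
  have g_cont: "continuous_on S g" for S
  proof -
    have rad: "0 \<le> k\<^sup>2 - 8 * (1 + cos (2 * pi * t))" for t
      using cos_le_one[of "2 * pi * t"] k_sq36 by argo
    have "0 < (k + sqrt (k\<^sup>2 - 8 * (1 + cos (2 * pi * t)))) / 2" for t
      using k real_sqrt_ge_zero[OF rad[of t]] by argo
    from this[THEN less_imp_neq, THEN not_sym] show ?thesis
      unfolding g_def by (intro continuous_intros) auto
  qed
  have g_per: "g (t + 1) = g t" for t
    by (simp add: g_def ring_distribs)
  have h_per: "h (t + 1) = h t" for t
  proof -
    have "z (t + 1) = z t"
      by (simp add: z_def ring_distribs)
    then show ?thesis
      by (simp only: h_def A_def)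
  qed
  have "integral {0..1} (\<lambda>t. g (2 * t + 1 / 2)) = integral {0..1} (\<lambda>t. g (t + 1 / 2))"
  proof (rule integral_periodic_double)
    show "continuous_on UNIV (\<lambda>t. g (t + 1 / 2))"
      by (rule continuous_on_compose2[OF g_cont[of UNIV]]) (auto intro!: continuous_intros)
    show "g (t + 1 + 1 / 2) = g (t + 1 / 2)" for t
      using g_per[of "t + 1 / 2"] by (simp only: add_ac)
  qed
  also have "\<dots> = integral {0..1} g"
    by (rule integral_periodic_shift[OF g_cont g_per]) auto
  finally have g_int: "integral {0..1} (\<lambda>t. g (2 * t + 1 / 2)) = integral {0..1} g" .
  \<comment> \<open>Averaging over the pair t, t + 1 / 2 replaces \<open>h\<close> by
    \<open>ln \<alpha>\<close> plus \<open>g\<close> at \<open>2 * t + 1 / 2\<close>, whose mean is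
    that of \<open>g\<close>.\<close>
  have "2 * integral {0..1} h = integral {0..1} h + integral {0..1} (\<lambda>t. h (t + 1 / 2))"
    using integral_periodic_shift[OF h_cont h_per, of "1 / 2"] by simp
  also have "\<dots> = integral {0..1} (\<lambda>t. h t + h (t + 1 / 2))"
    by (intro integral_add[symmetric] integrable_continuous_real h_cont
        continuous_on_compose2[OF h_cont[of UNIV]] continuous_intros) auto
  also have "\<dots> = integral {0..1} (\<lambda>t. 2 * ln \<alpha> + 2 * g (2 * t + 1 / 2))"
    by (simp only: h_sum g_def R_double)
  also have "\<dots> = integral {0..1} (\<lambda>t::real. 2 * ln \<alpha>) + integral {0..1} (\<lambda>t. 2 * g (2 * t + 1 / 2))"
    by (intro integral_add integrable_continuous_real continuous_intros
        continuous_on_compose2[OF g_cont[of UNIV]]) auto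
  also have "\<dots> = 2 * ln \<alpha> + 2 * integral {0..1} g"
    by (simp add: g_int)
  finally have "integral {0..1} h = ln \<alpha> + integral {0..1} g"
    by simp
  moreover have "2 * mahler_measure (P_fam a c) = integral {0..1} h"
    using mahler_measure_P_fam_imaginary[of \<alpha> \<gamma>] \<open>\<alpha> > 0\<close> \<open>2 * \<alpha> < \<gamma>\<close>
    by (simp only: a c h_def[abs_def] A_def z_def less_imp_le)
  moreover have "mahler_measure (P_fam 1 (of_real k)) = integral {0..1} g"
    using mahler_measure_P_fam_1[of k] k by (simp add: g_def[abs_def])
  moreover have "1 / 2 * ln ((k - 4) / (k + 4)) = - ln \<alpha>"
    using k by (simp add: \<alpha>_def ln_sqrt ln_div field_simps)
  ultimately show ?thesis
    by simp
qed

end
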